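(* Let $\mathbf{r}$ be a finite table, $X$ a non-empty set of attributes and $A, B$ two attributes. The unconditional implicit-to-implicit order compatibility (I/I OC) candidate $X\colon A^*\sim B^*$ is valid over $\mathbf{r}$ if and only if the corresponding SAT instance is satisfiable.
   Context: A table $\mathbf{r}$ is a finite collection of tuples; $t_C$ is the value of tuple $t$ on attribute $C$. The partition groups of $\mathbf r$ by an attribute set $X$ are the maximal sets of tuples agreeing on all attributes of $X$. A strong total order is a transitive, irreflexive relation in which any two distinct elements are comparable; a strong partial order is a transitive, irreflexive (hence antisymmetric) relation. For a strong total order $T$ on a set of tuples and an attribute $C$, list the $C$-values of the tuples in the order $T$ and collapse adjacent equal values. If no value then occurs twice, $T$ is said to project to a strong total order on $C$'s values, called the order derived from $T$ on $C$. A witness for $A^*\sim B^*$ over a set $E$ of tuples is a strong total order on $E$ that projects to a strong total order both on the $A$-values and on the $B$-values of $E$. (No order on $A$ or $B$ is given.) The unconditional I/I OC $X\colon A^*\sim B^*$ is valid over $\mathbf r$ if there are a strong partial order $P_A$ on the $A$-values, a strong partial order $P_B$ on the $B$-values, and, for every partition group of $\mathbf r$ by $X$, a witness whose derived orders on $A$ and on $B$ are contained in $P_A$ and $P_B$, respectively. The corresponding SAT instance: for each partition group $E_i$ of $\mathbf r$ by $X$, let $BG_i$ be the bipartite graph with the $A$-values occurring in $E_i$ on the left, the $B$-values occurring in $E_i$ on the right, and an edge $(t_A,t_B)$ for each $t\in E_i$. Let $l_1,\dots,l_m$ be the distinct $A$-values and $r_1,\dots,r_k$ the distinct $B$-values in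 $\mathbf{r}$. The propositional variables are $l_{i,j}$ ($1\le i,j\le m$, read as $l_i\prec l_j$) and $r_{i,j}$ ($1\le i,j\le k$, read as $r_i\prec r_j$). The clauses are: (1) $\neg l_{i,j}\lor\neg l_{j,i}$ for all $i\neq j$, and $\neg r_{i,j}\lor\neg r_{j,i}$ for all $i\ne j$; (2) (no swaps) for every $i$ and all edges $(l_u,r_t),(l_v,r_w)$ of $BG_i$ with $l_u\neq l_v$ and $r_t\ne r_w$: $(l_{u,v}\lor r_{w,t})\land(l_{v,u}\lor r_{t,w})$ (which, given (1), is equivalent to $(l_{u,v}\land r_{t,w})\lor(l_{v,u}\land r_{w,t})$); (3) (transitivity) $(l_{u,v}\land l_{v,w})\Rightarrow l_{u,w}$ for all distinct $u,v,w\in\{1,\dots,m\}$, and $(r_{u,v}\land r_{v,w})\Rightarrow r_{u,w}$ for all distinct $u,v,w\in\{1,\dots,k\}$. *)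

theory Defs
  imports Main
begin

text \<open>
  A table is a finite set of rows together with a function \<open>val\<close>, where \<open>val t C\<close> is the value
  \<open>t\<^sub>C\<close>. The row type is abstract, so that two different rows may carry the same values.
\<close>

definition attr_values :: "('t \<Rightarrow> 'c \<Rightarrow> 'v) \<Rightarrow> 't set \<Rightarrow> 'c \<Rightarrow> 'v set" where
  "attr_values val E C = (\<lambda>t. val t C) ` E"

definition agree_on :: "('t \<Rightarrow> 'c \<Rightarrow> 'v) \<Rightarrow> 'c set \<Rightarrow> 't set \<Rightarrow> bool" where
  "agree_on val X E \<longleftrightarrow> (\<forall>s\<in>E. \<forall>t\<in>E. \<forall>C\<in>X. val s C = val t C)"

definition partition_groups :: "('t \<Rightarrow> 'c \<Rightarrow> 'v) \<Rightarrow> 't set \<Rightarrow> 'c set \<Rightarrow> 't set set" where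
  "partition_groups val rows X =
     {E. E \<subseteq> rows \<and> E \<noteq> {} \<and> agree_on val X E \<and>
         (\<forall>F. E \<subseteq> F \<and> F \<subseteq> rows \<and> agree_on val X F \<longrightarrow> F = E)}"

definition strong_partial_order_on :: "'a set \<Rightarrow> 'a rel \<Rightarrow> bool" where
  "strong_partial_order_on S P \<longleftrightarrow> P \<subseteq> S \<times> S \<and> trans P \<and> irrefl P"

definition strong_total_order_on :: "'a set \<Rightarrow> 'a rel \<Rightarrow> bool" where
  "strong_total_order_on S T \<longleftrightarrow> T \<subseteq> S \<times> S \<and> strict_linear_order_on S T"

definition order_listing :: "'t set \<Rightarrow> 't rel \<Rightarrow> 't list" where
  "order_listing E T = (THE ts. set ts = E \<and> distinct ts \<and> sorted_wrt (\<lambda>s t. (s, t) \<in> T) ts)"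

text \<open>The description in \<open>order_listing\<close> is unique when the set is finite:\<close>

lemma ex1_order_listing:
  assumes "finite E" "strong_total_order_on E T"
  shows "\<exists>!ts. set ts = E \<and> distinct ts \<and> sorted_wrt (\<lambda>s t. (s, t) \<in> T) ts"
  using assms
proof (induction "card E" arbitrary: E T)
  case 0
  then show ?case by auto
next
  case (Suc n)
  have lin: "trans T" "irrefl T" "total_on E T" "T \<subseteq> E \<times> E"
    using Suc.prems by (auto simp: strong_total_order_on_def strict_linear_order_on_def)
  have "wf T"
    using Suc.prems(1) lin finite_subset[OF lin(4)]
    by (intro finite_acyclic_wf) (auto simp: acyclic_irrefl)
  moreover obtain e where "e \<in> E" using Suc.hyps(2) by fastforce
  ultimately obtain x where x: "x \<in> E" "\<And>y. (y, x) \<in> T \<Longrightarrow> y \<notin> E"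
    by (rule wfE_min) blast
  have min: "(x, y) \<in> T" if "y \<in> E" "y \<noteq> x" for y
    using x that lin(3) by (auto simp: total_on_def)
  let ?E = "E - {x}" and ?T = "T \<inter> (E - {x}) \<times> (E - {x})"
  let ?P = "\<lambda>E T ts. set ts = E \<and> distinct ts \<and> sorted_wrt (\<lambda>s t. (s, t) \<in> T) ts"
  have T': "strong_total_order_on ?E ?T"
    using lin unfolding strong_total_order_on_def strict_linear_order_on_def
    by (intro conjI transI) (auto simp: irrefl_def total_on_def dest: transD)
  have "n = card ?E" using Suc.hyps(2) x(1) Suc.prems(1) by simp
  then have "\<exists>!ts. ?P ?E ?T ts"
    by (rule Suc.hyps(1)) (use Suc.prems(1) T' in auto)
  then obtain us where us: "?P ?E ?T us" "\<And>vs. ?P ?E ?T vs \<Longrightarrow> vs = us" by (elim ex1E) blast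
  have sub: "sorted_wrt (\<lambda>s t. (s, t) \<in> T) vs \<longleftrightarrow> sorted_wrt (\<lambda>s t. (s, t) \<in> ?T) vs"
    if "set vs = ?E" for vs
  proof -
    have "vs ! i \<in> ?E" if "i < length vs" for i
      using that \<open>set vs = ?E\<close> nth_mem by blast
    then have "vs ! i \<in> ?E \<and> vs ! j \<in> ?E" if "i < j" "j < length vs" for i j
      using that order.strict_trans by blast
    then show ?thesis unfolding sorted_wrt_iff_nth_less by blast
  qed
  show ?case
  proof (rule ex1I[of _ "x # us"])
    show "?P E T (x # us)" using us(1) sub[of us] x(1) min by (simp add: insert_absorb)
  next
    fix ts assume ts: "?P E T ts"
    then obtain y vs where yv: "ts = y # vs" using x(1) by (cases ts) auto
    have "y = x"
    proof (rule ccontr)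
      assume "y \<noteq> x"
      then have "x \<in> set vs" using ts yv x(1) by auto
      then have "(y, x) \<in> T" using ts yv by simp
      then show False using x(2) lin(4) by blast
    qed
    moreover have "set vs = ?E" using ts yv \<open>y = x\<close> by auto
    then have "vs = us" using ts yv sub[of vs] us(2)[of vs] by simp
    ultimately show "ts = x # us" using yv by simp
  qed
qed

definition collapsed_values :: "'t set \<Rightarrow> 't rel \<Rightarrow> ('t \<Rightarrow> 'v) \<Rightarrow> 'v list" where
  "collapsed_values E T f = remdups_adj (map f (order_listing E T))"

definition projects_to_order :: "'t set \<Rightarrow> 't rel \<Rightarrow> ('t \<Rightarrow> 'v) \<Rightarrow> bool" where
  "projects_to_order E T f \<longleftrightarrow> distinct (collapsed_values E T f)"

definition derived_order :: "'t set \<Rightarrow> 't rel \<Rightarrow> ('t \<Rightarrow> 'v) \<Rightarrow> 'v rel" where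
  "derived_order E T f =
     {(collapsed_values E T f ! i, collapsed_values E T f ! j) | i j.
        i < j \<and> j < length (collapsed_values E T f)}"

definition is_witness :: "('t \<Rightarrow> 'c \<Rightarrow> 'v) \<Rightarrow> 'c \<Rightarrow> 'c \<Rightarrow> 't set \<Rightarrow> 't rel \<Rightarrow> bool" where
  "is_witness val A B E T \<longleftrightarrow>
     strong_total_order_on E T \<and>
     projects_to_order E T (\<lambda>t. val t A) \<and> projects_to_order E T (\<lambda>t. val t B)"

definition ii_oc_valid :: "('t \<Rightarrow> 'c \<Rightarrow> 'v) \<Rightarrow> 't set \<Rightarrow> 'c set \<Rightarrow> 'c \<Rightarrow> 'c \<Rightarrow> bool" where
  "ii_oc_valid val rows X A B \<longleftrightarrow>
     (\<exists>P_A P_B.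
        strong_partial_order_on (attr_values val rows A) P_A \<and>
        strong_partial_order_on (attr_values val rows B) P_B \<and>
        (\<forall>E\<in>partition_groups val rows X. \<exists>T. is_witness val A B E T \<and>
           derived_order E T (\<lambda>t. val t A) \<subseteq> P_A \<and> derived_order E T (\<lambda>t. val t B) \<subseteq> P_B))"

datatype 'p literal = Pos 'p | Neg 'p

type_synonym 'p clause = "'p literal set"
type_synonym 'p cnf = "'p clause set"

fun literal_true :: "('p \<Rightarrow> bool) \<Rightarrow> 'p literal \<Rightarrow> bool" where
  "literal_true \<sigma> (Pos p) = \<sigma> p"
| "literal_true \<sigma> (Neg p) = (\<not> \<sigma> p)"

definition satisfiable :: "'p cnf \<Rightarrow> bool" where
  "satisfiable F \<longleftrightarrow> (\<exists>\<sigma>. \<forall>c\<in>F. \<exists>x\<in>c. literal_true \<sigma> x)"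

text \<open>The vertices of the bipartite graph are exactly the endpoints of its edges.\<close>

definition bg_edges :: "('t \<Rightarrow> 'c \<Rightarrow> 'v) \<Rightarrow> 'c \<Rightarrow> 'c \<Rightarrow> 't set \<Rightarrow> ('v \<times> 'v) set" where
  "bg_edges val A B E = (\<lambda>t. (val t A, val t B)) ` E"

text \<open>\<open>LVar i j\<close> and \<open>RVar i j\<close> stand for \<open>l\<^sub>i \<prec> l\<^sub>j\<close> and \<open>r\<^sub>i \<prec> r\<^sub>j\<close>.\<close>

datatype pvar = LVar nat nat | RVar nat nat

definition antisym_clauses :: "(nat \<Rightarrow> nat \<Rightarrow> pvar) \<Rightarrow> nat \<Rightarrow> pvar cnf" where
  "antisym_clauses V n =
     {{Neg (V i j), Neg (V j i)} | i j. i \<in> {1..n} \<and> j \<in> {1..n} \<and> i \<noteq> j}"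

definition trans_clauses :: "(nat \<Rightarrow> nat \<Rightarrow> pvar) \<Rightarrow> nat \<Rightarrow> pvar cnf" where
  "trans_clauses V n =
     {{Neg (V u v), Neg (V v w), Pos (V u w)} | u v w.
        u \<in> {1..n} \<and> v \<in> {1..n} \<and> w \<in> {1..n} \<and> u \<noteq> v \<and> v \<noteq> w \<and> u \<noteq> w}"

definition no_swap_clauses ::
  "nat \<Rightarrow> (nat \<Rightarrow> 'v) \<Rightarrow> nat \<Rightarrow> (nat \<Rightarrow> 'v) \<Rightarrow> ('v \<times> 'v) set \<Rightarrow> pvar cnf" where
  "no_swap_clauses m l k r G =
     (\<Union>{{{Pos (LVar u v), Pos (RVar w t)}, {Pos (LVar v u), Pos (RVar t w)}} | u v t w.
           u \<in> {1..m} \<and> v \<in> {1..m} \<and> t \<in> {1..k} \<and> w \<in> {1..k} \<and>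
           (l u, r t) \<in> G \<and> (l v, r w) \<in> G \<and> l u \<noteq> l v \<and> r t \<noteq> r w})"

text \<open>
  Here \<open>l 1, \<dots>, l m\<close> and \<open>r 1, \<dots>, r k\<close> are meant to enumerate, without repetition, the
  values of \<open>A\<close> and of \<open>B\<close> in the whole table.
\<close>

definition ii_oc_cnf ::
  "('t \<Rightarrow> 'c \<Rightarrow> 'v) \<Rightarrow> 't set \<Rightarrow> 'c set \<Rightarrow> 'c \<Rightarrow> 'c \<Rightarrow>
   nat \<Rightarrow> (nat \<Rightarrow> 'v) \<Rightarrow> nat \<Rightarrow> (nat \<Rightarrow> 'v) \<Rightarrow> pvar cnf" where
  "ii_oc_cnf val rows X A B m l k r =
     antisym_clauses LVar m \<union> antisym_clauses RVar k \<union>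
     (\<Union>E\<in>partition_groups val rows X. no_swap_clauses m l k r (bg_edges val A B E)) \<union>
     trans_clauses LVar m \<union> trans_clauses RVar k"

end

theory Submission
  imports Defs
begin

text \<open>
  A valid candidate yields a satisfying assignment by reading the two partial orders as truth
  values. Conversely, a satisfying assignment only gives partial orders, and two values that share
  their only partner in a group need not be comparable in them. So both are first extended to
  linear orders of all values of the table; each group, sorted lexicographically by its
  \<open>A\<close>-value and then its \<open>B\<close>-value, is then also sorted by \<open>B\<close>-value, because the swap clauses
  force the two orders to agree on tuples that differ in both values.
\<close>

section \<open>Collapsed listings and derived orders\<close>

lemma order_listing_spec:
  assumes "finite E" "strong_total_order_on E T"
  shows "set (order_listing E T) = E" "distinct (order_listing E T)"
    "sorted_wrt (\<lambda>s t. (s, t) \<in> T) (order_listing E T)"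
  using theI'[OF ex1_order_listing[OF assms]] unfolding order_listing_def by blast+

text \<open>Collapsing moves positions by a monotone index map \<open>h\<close> that preserves
  entries; different entries have different images under \<open>h\<close>, so their order survives
  strictly.\<close>

lemma remdups_adj_index:
  assumes "i < j" "j < length xs" "xs ! i \<noteq> xs ! j"
  obtains i' j' where "i' < j'" "j' < length (remdups_adj xs)"
    "remdups_adj xs ! i' = xs ! i" "remdups_adj xs ! j' = xs ! j"
proof -
  obtain h :: "nat \<Rightarrow> nat" where h: "mono h" "h ` {0..<length xs} = {0..<length (remdups_adj xs)}"
    "\<And>n. n < length xs \<Longrightarrow> xs ! n = remdups_adj xs ! h n"
    using remdups_adj_altdef[of xs "remdups_adj xs"] by blast
  have "h i \<le> h j" using h(1) assms(1) by (simp add: monoD)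
  moreover have "h i \<noteq> h j" using h(3) assms by (metis order.strict_trans)
  moreover have "h j < length (remdups_adj xs)" using h(2) assms(2) by auto
  ultimately show thesis using that[of "h i" "h j"] h(3) assms by simp
qed

text \<open>Carries a comparison of tuples over to their values, which is how a witness makes swap
  clauses true.\<close>

lemma derived_orderI:
  assumes "finite E" "strong_total_order_on E T" "(s, t) \<in> T" "f s \<noteq> f t"
  shows "(f s, f t) \<in> derived_order E T f"
proof -
  let ?ts = "order_listing E T"
  note spec = order_listing_spec[OF assms(1,2)]
  have T: "T \<subseteq> E \<times> E" "trans T" "irrefl T"
    using assms(2) by (auto simp: strong_total_order_on_def strict_linear_order_on_def)
  obtain i j where ij: "i < length ?ts" "?ts ! i = s" "j < length ?ts" "?ts ! j = t"
    using assms(3) T(1) spec(1) by (metis SigmaD1 SigmaD2 in_set_conv_nth subsetD)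
  \<comment> \<open>Otherwise the sorted listing yields \<open>(t, s) \<in> T\<close> or
    \<open>s = t\<close>, against the asymmetry of \<open>T\<close>.\<close>
  have "i < j"
  proof (rule ccontr)
    assume "\<not> i < j"
    then have "j < i \<or> s = t" using ij by (metis linorder_neqE_nat)
    then have "(t, s) \<in> T \<or> s = t" using spec(3) ij by (auto simp: sorted_wrt_iff_nth_less)
    then show False using assms(3) T by (meson irreflD transD)
  qed
  then obtain i' j' where "i' < j'" "j' < length (remdups_adj (map f ?ts))"
    "remdups_adj (map f ?ts) ! i' = f s" "remdups_adj (map f ?ts) ! j' = f t"
    using remdups_adj_index[of i j "map f ?ts"] ij assms(4) by auto
  then show ?thesis
    unfolding derived_order_def collapsed_values_def mem_Collect_eq by metis
qed

text \<open>If \<open>x\<close> differs from its neighbour \<open>y\<close>, then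
  \<open>P x y\<close>, and each later \<open>z\<close> is \<open>y\<close> or satisfies
  \<open>P y z\<close>; transitivity gives \<open>P x z\<close>.\<close>

lemma sorted_wrt_remdups_adj:
  assumes "transp P" "sorted_wrt (\<lambda>x y. x = y \<or> P x y) xs"
  shows "sorted_wrt P (remdups_adj xs)"
  using assms(2)
proof (induction xs rule: remdups_adj.induct)
  case (3 x y xs)
  then show ?case using assms(1) by (auto dest: transpD)
qed auto

lemma sorted_collapsed_values:
  fixes g :: "'v \<Rightarrow> nat"
  assumes "finite E" "strong_total_order_on E T"
    and mono: "\<And>s t. (s, t) \<in> T \<Longrightarrow> f s = f t \<or> g (f s) < g (f t)"
  shows "sorted_wrt (\<lambda>a b. g a < g b) (collapsed_values E T f)"
proof -
  have "sorted_wrt (\<lambda>a b. a = b \<or> g a < g b) (map f (order_listing E T))"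
    unfolding sorted_wrt_map using order_listing_spec(3)[OF assms(1,2)] mono
    by (rule sorted_wrt_mono_rel[rotated])
  then show ?thesis
    unfolding collapsed_values_def by (intro sorted_wrt_remdups_adj) (auto intro: transpI)
qed

text \<open>The rank \<open>g\<close> increases strictly along the collapsed list, so no value can
  return and every derived pair increases in rank.\<close>

lemma projects_and_derived_order:
  fixes g :: "'v \<Rightarrow> nat"
  assumes "finite E" "strong_total_order_on E T"
    and "\<And>s t. (s, t) \<in> T \<Longrightarrow> f s = f t \<or> g (f s) < g (f t)"
  shows "projects_to_order E T f"
    and "derived_order E T f \<subseteq> {(a, b). a \<in> f ` E \<and> b \<in> f ` E \<and> g a < g b}"
proof -
  let ?vs = "collapsed_values E T f"
  have lt: "g (?vs ! i) < g (?vs ! j)" if "i < j" "j < length ?vs" for i j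
    using sorted_collapsed_values[of E T f g] assms that by (simp add: sorted_wrt_iff_nth_less)
  then show "projects_to_order E T f"
    unfolding projects_to_order_def distinct_conv_nth by (metis less_irrefl linorder_neqE_nat)
  have "set ?vs = f ` E"
    using order_listing_spec(1)[OF assms(1,2)] by (simp add: collapsed_values_def)
  then show "derived_order E T f \<subseteq> {(a, b). a \<in> f ` E \<and> b \<in> f ` E \<and> g a < g b}"
    unfolding derived_order_def using lt nth_mem order.strict_trans by blast
qed

section \<open>Linear extensions as injective rankings\<close>

text \<open>Elements are ranked by their number of predecessors \<open>h\<close>, with ties broken
  by a numbering \<open>e\<close> with values below \<open>n\<close>; \<open>h a * n + e a\<close>
  encodes this lexicographic key as one number.\<close>

lemma linear_extension_rank:
  assumes "finite S" "strong_partial_order_on S P"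
  obtains g :: "'a \<Rightarrow> nat" where "inj_on g S" "\<And>a b. (a, b) \<in> P \<Longrightarrow> g a < g b"
proof -
  obtain e :: "'a \<Rightarrow> nat" and n where e: "e ` S = {i. i < n}" "inj_on e S"
    using finite_imp_inj_to_nat_seg[OF assms(1)] by blast
  have e_less: "e a < n" if "a \<in> S" for a using e(1) that by blast
  have P: "P \<subseteq> S \<times> S" "trans P" "irrefl P"
    using assms(2) by (auto simp: strong_partial_order_on_def)
  define h where "h a = card {b. (b, a) \<in> P}" for a
  define g where "g a = h a * n + e a" for a
  have "inj_on g S"
  proof (rule inj_onI)
    fix a b assume ab: "a \<in> S" "b \<in> S" "g a = g b"
    \<comment> \<open>The remainder modulo \<open>n\<close> recovers the injective
      tie-breaker.\<close>
    have "g c mod n = e c" if "c \<in> S" for c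
      using e_less[OF that] by (simp add: g_def)
    then have "e a = e b" using ab by metis
    then show "a = b" using ab(1,2) e(2) by (simp add: inj_onD)
  qed
  moreover have "g a < g b" if ab: "(a, b) \<in> P" for a b
  proof -
    \<comment> \<open>Strict because \<open>a\<close> precedes \<open>b\<close> but not
      itself.\<close>
    have "{c. (c, a) \<in> P} \<subset> {c. (c, b) \<in> P}"
      using ab P by (auto simp: irrefl_def dest: transD)
    moreover have "finite {c. (c, b) \<in> P}"
      by (rule finite_subset[OF _ assms(1)]) (use P(1) in blast)
    ultimately have "h a < h b" unfolding h_def by (rule psubset_card_mono[rotated])
    \<comment> \<open>One more predecessor is worth \<open>n\<close>, which outweighs the
      tie-breaker \<open>e a\<close>.\<close>
    then have "(h a + 1) * n \<le> h b * n" by (intro mult_right_mono) auto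
    moreover have "e a < n" using e_less ab P(1) by blast
    ultimately show ?thesis by (simp add: g_def)
  qed
  ultimately show thesis using that by blast
qed

lemma strong_partial_order_on_rank:
  fixes g :: "'a \<Rightarrow> nat"
  shows "strong_partial_order_on S {(a, b). a \<in> S \<and> b \<in> S \<and> g a < g b}"
  by (auto simp: strong_partial_order_on_def irrefl_def intro: transI)

section \<open>Constructing a witness for one group\<close>

lemma lexicographic_witness:
  fixes val :: "'t \<Rightarrow> 'c \<Rightarrow> 'v" and g h :: "'v \<Rightarrow> nat"
  assumes "finite E" "E \<subseteq> rows"
    and "inj_on g (attr_values val rows A)" "inj_on h (attr_values val rows B)"
    and no_swap: "\<And>s t. \<lbrakk>s \<in> E; t \<in> E; val s A \<noteq> val t A; val s B \<noteq> val t B\<rbrakk>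
      \<Longrightarrow> g (val s A) < g (val t A) \<longleftrightarrow> h (val s B) < h (val t B)"
  obtains T where "is_witness val A B E T"
    "derived_order E T (\<lambda>t. val t A) \<subseteq>
       {(a, b). a \<in> attr_values val rows A \<and> b \<in> attr_values val rows A \<and> g a < g b}"
    "derived_order E T (\<lambda>t. val t B) \<subseteq>
       {(a, b). a \<in> attr_values val rows B \<and> b \<in> attr_values val rows B \<and> h a < h b}"
proof -
  obtain e :: "'t \<Rightarrow> nat" where e: "inj_on e E"
    using finite_imp_inj_to_nat_seg[OF assms(1)] by blast
  \<comment> \<open>The third component separates tuples that coincide in both values, making
    \<open>T\<close> total on \<open>E\<close>.\<close>
  define key where "key t = (g (val t A), h (val t B), e t)" for t
  define T where "T = {(s, t). s \<in> E \<and> t \<in> E \<and>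
    (key s, key t) \<in> less_than <*lex*> less_than <*lex*> less_than}"
  have e_neq: "e s < e t \<or> e t < e s" if "s \<in> E" "t \<in> E" "s \<noteq> t" for s t
    using e that by (metis inj_onD linorder_neqE_nat)
  have T: "strong_total_order_on E T"
    unfolding strong_total_order_on_def strict_linear_order_on_def
  proof (intro conjI)
    show "trans T" unfolding T_def key_def by (rule transI) auto
    show "irrefl T" unfolding T_def key_def by (auto simp: irrefl_def)
    show "total_on E T"
      unfolding T_def key_def using e_neq by (auto simp: total_on_def)
  qed (auto simp: T_def)
  have in_rows: "val t C \<in> attr_values val rows C" if "t \<in> E" for t C
    using assms(2) that by (auto simp: attr_values_def)
  have eqA: "val s A = val t A" if "s \<in> E" "t \<in> E" "g (val s A) = g (val t A)" for s t
    using inj_onD[OF assms(3)] in_rows that by blast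
  have eqB: "val s B = val t B" if "s \<in> E" "t \<in> E" "h (val s B) = h (val t B)" for s t
    using inj_onD[OF assms(4)] in_rows that by blast
  have monoA: "val s A = val t A \<or> g (val s A) < g (val t A)" if "(s, t) \<in> T" for s t
    using that eqA by (auto simp: T_def key_def)
  \<comment> \<open>Equal \<open>A\<close>-values leave the comparison to the second key. Otherwise
    the \<open>A\<close>-rank increases, and \<open>no_swap\<close> transfers this to
    \<open>B\<close> unless the \<open>B\<close>-values coincide.\<close>
  have monoB: "val s B = val t B \<or> h (val s B) < h (val t B)" if st: "(s, t) \<in> T" for s t
  proof (cases "val s A = val t A")
    case True
    then show ?thesis using st eqB by (auto simp: T_def key_def)
  next
    case False
    then show ?thesis using monoA[OF st] no_swap st by (auto simp: T_def)
  qed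
  have sub: "(\<lambda>t. val t C) ` E \<subseteq> attr_values val rows C" for C
    using in_rows by blast
  show thesis
  proof (rule that)
    show "is_witness val A B E T"
      using T projects_and_derived_order(1)[OF assms(1) T, of "\<lambda>t. val t A" g, OF monoA]
        projects_and_derived_order(1)[OF assms(1) T, of "\<lambda>t. val t B" h, OF monoB]
      by (simp add: is_witness_def)
  qed (use projects_and_derived_order(2)[OF assms(1) T, of "\<lambda>t. val t A" g, OF monoA]
      projects_and_derived_order(2)[OF assms(1) T, of "\<lambda>t. val t B" h, OF monoB] sub in blast)+
qed

lemma partition_groups_subset: "E \<in> partition_groups val rows X \<Longrightarrow> E \<subseteq> rows"
  by (simp add: partition_groups_def)

lemma no_swap_clausesI:
  assumes "u \<in> {1..m}" "v \<in> {1..m}" "t \<in> {1..k}" "w \<in> {1..k}"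
    and "(l u, r t) \<in> G" "(l v, r w) \<in> G" "l u \<noteq> l v" "r t \<noteq> r w"
  shows "{Pos (LVar u v), Pos (RVar w t)} \<in> no_swap_clauses m l k r G"
    and "{Pos (LVar v u), Pos (RVar t w)} \<in> no_swap_clauses m l k r G"
  using assms unfolding no_swap_clauses_def by blast+

section \<open>Assignments and partial orders\<close>

text \<open>The clauses leave the diagonal variables \<open>V i i\<close> free, so the relation
  keeps only pairs with \<open>i \<noteq> j\<close>; injectivity of \<open>l\<close> then gives
  irreflexivity. The parameter \<open>V\<close> lets one proof serve both \<open>LVar\<close> and
  \<open>RVar\<close>.\<close>

lemma order_of_assignment:
  assumes bij: "bij_betw l {1..n} S"
    and antisym: "\<And>c. c \<in> antisym_clauses V n \<Longrightarrow> \<exists>x\<in>c. literal_true \<sigma> x"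
    and trans: "\<And>c. c \<in> trans_clauses V n \<Longrightarrow> \<exists>x\<in>c. literal_true \<sigma> x"
  shows "strong_partial_order_on S
    {(l i, l j) | i j. i \<in> {1..n} \<and> j \<in> {1..n} \<and> i \<noteq> j \<and> \<sigma> (V i j)}" (is "strong_partial_order_on _ ?P")
proof -
  have inj: "i = j" if "l i = l j" "i \<in> {1..n}" "j \<in> {1..n}" for i j
    using bij that by (auto simp: bij_betw_def dest: inj_onD)
  have a: "\<not> \<sigma> (V i j) \<or> \<not> \<sigma> (V j i)" if "i \<in> {1..n}" "j \<in> {1..n}" "i \<noteq> j" for i j
    using antisym[of "{Neg (V i j), Neg (V j i)}"] that
    unfolding antisym_clauses_def by auto
  have t: "\<sigma> (V u w)" if "\<sigma> (V u v)" "\<sigma> (V v w)"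
    "u \<in> {1..n}" "v \<in> {1..n}" "w \<in> {1..n}" "u \<noteq> v" "v \<noteq> w" "u \<noteq> w" for u v w
  proof -
    have "{Neg (V u v), Neg (V v w), Pos (V u w)} \<in> trans_clauses V n"
      using that unfolding trans_clauses_def by blast
    from trans[OF this] show ?thesis using that by auto
  qed
  have "?P \<subseteq> S \<times> S" using bij by (auto simp: bij_betw_def)
  moreover have "trans ?P"
  proof (rule transI)
    fix x y z assume "(x, y) \<in> ?P" "(y, z) \<in> ?P"
    then obtain u v v' w where "x = l u" "y = l v" "y = l v'" "z = l w"
      and mem: "u \<in> {1..n}" "v \<in> {1..n}" "v' \<in> {1..n}" "w \<in> {1..n}" "u \<noteq> v" "v' \<noteq> w"
      and \<sigma>: "\<sigma> (V u v)" "\<sigma> (V v' w)" by blast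
    moreover from this have "v' = v" using inj by metis
    \<comment> \<open>Transitivity clauses cover only distinct indices; \<open>u = w\<close> would
      violate an antisymmetry clause.\<close>
    moreover from this have "u \<noteq> w" using a mem \<sigma> by blast
    ultimately show "(x, z) \<in> ?P" using t by blast
  qed
  moreover have "irrefl ?P" using inj by (auto simp: irrefl_def)
  ultimately show ?thesis by (simp add: strong_partial_order_on_def)
qed

section \<open>The two directions of the equivalence\<close>

lemma satisfiable_if_valid:
  fixes val :: "'t \<Rightarrow> 'c \<Rightarrow> 'v"
  assumes "finite rows" "ii_oc_valid val rows X A B"
    and "bij_betw l {1..m} (attr_values val rows A)"
    and "bij_betw r {1..k} (attr_values val rows B)"
  shows "satisfiable (ii_oc_cnf val rows X A B m l k r)"
proof -
  obtain PA PB where PA: "strong_partial_order_on (attr_values val rows A) PA"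
    and PB: "strong_partial_order_on (attr_values val rows B) PB"
    and wit: "\<And>E. E \<in> partition_groups val rows X \<Longrightarrow> \<exists>T. is_witness val A B E T \<and>
      derived_order E T (\<lambda>t. val t A) \<subseteq> PA \<and> derived_order E T (\<lambda>t. val t B) \<subseteq> PB"
    using assms(2) unfolding ii_oc_valid_def by blast
  have tr: "trans PA" "irrefl PA" "trans PB" "irrefl PB"
    using PA PB by (auto simp: strong_partial_order_on_def)
  define \<sigma> where
    "\<sigma> p = (case p of LVar i j \<Rightarrow> (l i, l j) \<in> PA | RVar i j \<Rightarrow> (r i, r j) \<in> PB)" for p
  have swap: "\<exists>x\<in>c. literal_true \<sigma> x"
    if E: "E \<in> partition_groups val rows X"
      and c: "c \<in> no_swap_clauses m l k r (bg_edges val A B E)" for E c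
  proof -
    obtain u v t w where edges: "(l u, r t) \<in> bg_edges val A B E" "(l v, r w) \<in> bg_edges val A B E"
      and ne: "l u \<noteq> l v" "r t \<noteq> r w"
      and c': "c = {Pos (LVar u v), Pos (RVar w t)} \<or> c = {Pos (LVar v u), Pos (RVar t w)}"
      using c unfolding no_swap_clauses_def by blast
    obtain p q where p: "p \<in> E" "val p A = l u" "val p B = r t"
      and q: "q \<in> E" "val q A = l v" "val q B = r w"
      using edges unfolding bg_edges_def by auto
    obtain T where T: "is_witness val A B E T"
      "derived_order E T (\<lambda>t. val t A) \<subseteq> PA" "derived_order E T (\<lambda>t. val t B) \<subseteq> PB"
      using wit[OF E] by blast
    have tot: "strong_total_order_on E T" using T(1) by (simp add: is_witness_def)
    have fin: "finite E" using partition_groups_subset[OF E] assms(1) by (rule finite_subset)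
    have derived: "(val x A, val y A) \<in> PA" "(val x B, val y B) \<in> PB"
      if "(x, y) \<in> T" "val x A \<noteq> val y A" "val x B \<noteq> val y B" for x y
      using derived_orderI[OF fin tot that(1), of "\<lambda>t. val t A"]
        derived_orderI[OF fin tot that(1), of "\<lambda>t. val t B"] that T by blast+
    have "p \<noteq> q" using p q ne by auto
    then have "(p, q) \<in> T \<or> (q, p) \<in> T" using tot p(1) q(1)
      by (auto simp: strong_total_order_on_def strict_linear_order_on_def total_on_def)
    \<comment> \<open>Whichever of \<open>p\<close> and \<open>q\<close> comes first in
      \<open>T\<close>, both pairs of values are ordered in the same direction. Each of the two swap
      clauses contains one literal from either alternative.\<close>
    then have "(l u, l v) \<in> PA \<and> (r t, r w) \<in> PB \<or> (l v, l u) \<in> PA \<and> (r w, r t) \<in> PB"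
      using derived[of p q] derived[of q p] p q ne by auto
    then show ?thesis using c' by (auto simp: \<sigma>_def)
  qed
  have antisym: "\<exists>x\<in>c. literal_true \<sigma> x"
    if "c \<in> antisym_clauses LVar m \<union> antisym_clauses RVar k" for c
  proof -
    \<comment> \<open>A cycle of length two would give a reflexive pair by transitivity.\<close>
    have "\<not> ((a, b) \<in> PA \<and> (b, a) \<in> PA)" "\<not> ((a, b) \<in> PB \<and> (b, a) \<in> PB)" for a b
      using tr by (meson irreflD transD)+
    then show ?thesis using that by (auto simp: antisym_clauses_def \<sigma>_def)
  qed
  have "\<exists>x\<in>c. literal_true \<sigma> x" if "c \<in> trans_clauses LVar m \<union> trans_clauses RVar k" for c
    using that tr(1,3) by (auto simp: trans_clauses_def \<sigma>_def dest: transD)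
  with swap antisym show ?thesis
    unfolding satisfiable_def ii_oc_cnf_def by (intro exI[of _ \<sigma>] ballI) blast
qed

lemma valid_if_satisfiable:
  fixes val :: "'t \<Rightarrow> 'c \<Rightarrow> 'v"
  assumes "finite rows" "satisfiable (ii_oc_cnf val rows X A B m l k r)"
    and "bij_betw l {1..m} (attr_values val rows A)"
    and "bij_betw r {1..k} (attr_values val rows B)"
  shows "ii_oc_valid val rows X A B"
proof -
  obtain \<sigma> where \<sigma>: "\<And>c. c \<in> ii_oc_cnf val rows X A B m l k r \<Longrightarrow> \<exists>x\<in>c. literal_true \<sigma> x"
    using assms(2) unfolding satisfiable_def by blast
  define PA where "PA = {(l i, l j) | i j. i \<in> {1..m} \<and> j \<in> {1..m} \<and> i \<noteq> j \<and> \<sigma> (LVar i j)}"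
  define PB where "PB = {(r i, r j) | i j. i \<in> {1..k} \<and> j \<in> {1..k} \<and> i \<noteq> j \<and> \<sigma> (RVar i j)}"
  have fin: "finite (attr_values val rows C)" for C
    using assms(1) by (simp add: attr_values_def)
  have PA: "strong_partial_order_on (attr_values val rows A) PA"
    unfolding PA_def by (rule order_of_assignment[OF assms(3)]) (auto intro!: \<sigma> simp: ii_oc_cnf_def)
  have PB: "strong_partial_order_on (attr_values val rows B) PB"
    unfolding PB_def by (rule order_of_assignment[OF assms(4)]) (auto intro!: \<sigma> simp: ii_oc_cnf_def)
  obtain g :: "'v \<Rightarrow> nat" where g: "inj_on g (attr_values val rows A)"
    "\<And>a b. (a, b) \<in> PA \<Longrightarrow> g a < g b"
    using linear_extension_rank[OF fin PA] by metis
  have g_less: "g (l i) < g (l j)"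
    if "\<sigma> (LVar i j)" "i \<in> {1..m}" "j \<in> {1..m}" "i \<noteq> j" for i j
    by (rule g(2)) (use that PA_def in blast)
  obtain h :: "'v \<Rightarrow> nat" where h: "inj_on h (attr_values val rows B)"
    "\<And>a b. (a, b) \<in> PB \<Longrightarrow> h a < h b"
    using linear_extension_rank[OF fin PB] by metis
  have h_less: "h (r i) < h (r j)"
    if "\<sigma> (RVar i j)" "i \<in> {1..k}" "j \<in> {1..k}" "i \<noteq> j" for i j
    by (rule h(2)) (use that PB_def in blast)
  \<comment> \<open>The bounding relations are the rank orders on all values of the table; they do
    not depend on \<open>E\<close> and so serve as the common \<open>P_A\<close> and
    \<open>P_B\<close>.\<close>
  have wit: "\<exists>T. is_witness val A B E T \<and>
      derived_order E T (\<lambda>t. val t A) \<subseteq>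
        {(a, b). a \<in> attr_values val rows A \<and> b \<in> attr_values val rows A \<and> g a < g b} \<and>
      derived_order E T (\<lambda>t. val t B) \<subseteq>
        {(a, b). a \<in> attr_values val rows B \<and> b \<in> attr_values val rows B \<and> h a < h b}"
    if E: "E \<in> partition_groups val rows X" for E
  proof -
    have sub: "E \<subseteq> rows" by (rule partition_groups_subset[OF E])
    have no_swap: "g (val s A) < g (val t A) \<longleftrightarrow> h (val s B) < h (val t B)"
      if st: "s \<in> E" "t \<in> E" "val s A \<noteq> val t A" "val s B \<noteq> val t B" for s t
    proof -
      have img: "val x A \<in> l ` {1..m}" "val x B \<in> r ` {1..k}" if "x \<in> E" for x
        using bij_betw_imp_surj_on[OF assms(3)] bij_betw_imp_surj_on[OF assms(4)] that sub
        unfolding attr_values_def by blast+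
      obtain u v where uv: "u \<in> {1..m}" "v \<in> {1..m}" "val s A = l u" "val t A = l v"
        using img(1)[OF st(1)] img(1)[OF st(2)] by blast
      obtain i j where ij: "i \<in> {1..k}" "j \<in> {1..k}" "val s B = r i" "val t B = r j"
        using img(2)[OF st(1)] img(2)[OF st(2)] by blast
      have ne: "l u \<noteq> l v" "r i \<noteq> r j" using st(3,4) uv(3,4) ij(3,4) by simp_all
      have edges: "(l u, r i) \<in> bg_edges val A B E" "(l v, r j) \<in> bg_edges val A B E"
        using st(1,2) unfolding uv(3,4)[symmetric] ij(3,4)[symmetric] bg_edges_def by blast+
      have cnf: "no_swap_clauses m l k r (bg_edges val A B E) \<subseteq> ii_oc_cnf val rows X A B m l k r"
        using E unfolding ii_oc_cnf_def by blast
      have "\<sigma> (LVar u v) \<or> \<sigma> (RVar j i)" "\<sigma> (LVar v u) \<or> \<sigma> (RVar i j)"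
        using no_swap_clausesI[OF uv(1,2) ij(1,2) edges ne, THEN subsetD[OF cnf], THEN \<sigma>]
        by simp_all
      moreover have "u \<noteq> v" "i \<noteq> j" using ne by blast+
      \<comment> \<open>By asymmetry of \<open><\<close>, the second disjunction gives the forward
        implication of \<open>no_swap\<close> and the first gives the converse.\<close>
      ultimately have "g (l u) < g (l v) \<or> h (r j) < h (r i)"
        "g (l v) < g (l u) \<or> h (r i) < h (r j)"
        using g_less h_less uv(1,2) ij(1,2) by metis+
      then show ?thesis unfolding uv(3,4) ij(3,4) by linarith
    qed
    have "finite E" using sub assms(1) by (rule finite_subset)
    then show ?thesis
      by (rule lexicographic_witness[OF _ sub g(1) h(1) no_swap]) (assumption | blast)+
  qed
  show ?thesis
    unfolding ii_oc_valid_def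
    using strong_partial_order_on_rank[of "attr_values val rows A" g]
      strong_partial_order_on_rank[of "attr_values val rows B" h] wit by blast
qed

theorem theorem7:
  fixes rows :: "'t set" and val :: "'t \<Rightarrow> 'c \<Rightarrow> 'v"
    and X :: "'c set" and A B :: 'c
    and m k :: nat and l r :: "nat \<Rightarrow> 'v"
  assumes "finite rows"
    and "X \<noteq> {}"
    and "bij_betw l {1..m} (attr_values val rows A)"
    and "bij_betw r {1..k} (attr_values val rows B)"
  shows "ii_oc_valid val rows X A B \<longleftrightarrow> satisfiable (ii_oc_cnf val rows X A B m l k r)"
  using satisfiable_if_valid valid_if_satisfiable assms by metis

end
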